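(* Let $G$ be a finite simple graph. All orientations $G^\sigma$ of $G$ have the same permanental polynomial $\pi(G^\sigma,x)$ if and only if $G$ has no even cycles (i.e. $G$ contains no cycle of even length as a subgraph).
   Context: An orientation $G^\sigma$ of a simple graph $G$ with vertex set $\{v_1,\dots,v_n\}$ assigns to each edge one of its two directions. The skew adjacency matrix $A_s(G^\sigma)=(a_{ij})$ is the $n\times n$ matrix with $a_{ij}=1$ if $(v_i,v_j)$ is an arc of $G^\sigma$, $a_{ij}=-1$ if $(v_j,v_i)$ is an arc of $G^\sigma$, and $a_{ij}=0$ otherwise. The permanent of $M=(m_{ij})$ is $\mathrm{per}(M)=\sum_{\pi\in S_n}\prod_{i=1}^{n}m_{i\pi(i)}$, and the permanental polynomial of $G^\sigma$ is $\pi(G^\sigma,x)=\mathrm{per}(xI-A_s(G^\sigma))$. *)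

theory Defs
  imports "Graph_Theory.Pair_Digraph" "Jordan_Normal_Form.Char_Poly"
begin

text \<open>
  A finite simple graph is a \<open>pair_graph\<close>: a finite loop-free symmetric digraph without
  parallel arcs. The edge joining \<open>u\<close> and \<open>v\<close> is represented by the two arcs \<open>(u, v)\<close>, \<open>(v, u)\<close>.
  An orientation keeps exactly one of them.
\<close>

definition orientation :: "'a pair_pre_digraph \<Rightarrow> 'a pair_pre_digraph \<Rightarrow> bool" where
  "orientation G H \<longleftrightarrow>
     pverts H = pverts G \<and> parcs H \<subseteq> parcs G \<and>
     (\<forall>(u, v) \<in> parcs G. (u, v) \<in> parcs H \<longleftrightarrow> (v, u) \<notin> parcs H)"

text \<open>
  The walk \<open>u, v, u\<close> along a single edge is a \<open>pre_digraph.cycle\<close> of length 2 of the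
  symmetric digraph, but not a cycle of the undirected graph. The length bound excludes it.
\<close>

definition graph_cycle :: "'a pair_pre_digraph \<Rightarrow> ('a \<times> 'a) list \<Rightarrow> bool" where
  "graph_cycle G p \<longleftrightarrow> pre_digraph.cycle (with_proj G) p \<and> 3 \<le> length p"

text \<open>
  The list \<open>vs\<close> is the enumeration of the vertices that indexes rows and columns;
  indices start at 0.
\<close>

definition skew_adjacency_mat :: "'a list \<Rightarrow> 'a pair_pre_digraph \<Rightarrow> int mat" where
  "skew_adjacency_mat vs H = mat (length vs) (length vs)
     (\<lambda>(i, j). if (vs ! i, vs ! j) \<in> parcs H then 1
               else if (vs ! j, vs ! i) \<in> parcs H then - 1
               else 0)"

text \<open>As for \<open>det\<close>, the value at a matrix that is not square is set to 0.\<close>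

definition permanent :: "'a :: comm_ring_1 mat \<Rightarrow> 'a" where
  "permanent M = (if dim_row M = dim_col M
     then (\<Sum>p \<in> {p. p permutes {0..<dim_row M}}. \<Prod>i = 0..<dim_row M. M $$ (i, p i))
     else 0)"

text \<open>\<open>char_poly_matrix A\<close> is the polynomial matrix \<open>x I - A\<close>.\<close>

definition permanental_poly :: "'a list \<Rightarrow> 'a pair_pre_digraph \<Rightarrow> int poly" where
  "permanental_poly vs H = permanent (char_poly_matrix (skew_adjacency_mat vs H))"

end

theory Submission
  imports Defs "HOL-Combinatorics.Orbits" "HOL-Combinatorics.Cycles"
begin

text \<open>
  If there is no even cycle, reversing one orbit of length at least 3 negates the term of a
  permutation, because that orbit either is an odd cycle of the graph or contributes a factor 0.
  So only the involutions contribute, and an edge \<open>uv\<close> swapped by an involution contributes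
  \<open>- a\<^sub>u\<^sub>v\<^sup>2\<close>, which does not depend on the orientation.

  Conversely, let all orientations have the same polynomial. Flipping an edge negates exactly the
  terms of the permutations that traverse it in one direction only. Starting from the full sum, it
  follows edge by edge that for every nonempty set of edges the terms of the permutations that
  traverse each of its edges in exactly one direction sum to 0. For the edges of a cycle of even
  length \<open>m\<close>, the coefficient of \<open>x\<close> to the power \<open>n - m\<close> in this sum comes only from the two
  rotations of the cycle; their contributions are \<open>\<plusminus>1\<close> with the same sign as \<open>m\<close> is even, so
  they do not cancel.
\<close>

section \<open>Permanents as sums over permutations of the vertices\<close>

definition perm_term :: "('a \<Rightarrow> 'a \<Rightarrow> 'b :: comm_ring_1) \<Rightarrow> 'a set \<Rightarrow> ('a \<Rightarrow> 'a) \<Rightarrow> 'b" where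
  "perm_term w V p = (\<Prod>v\<in>V. w v (p v))"

definition arc_sign :: "'a pair_pre_digraph \<Rightarrow> 'a \<Rightarrow> 'a \<Rightarrow> int" where
  "arc_sign H u v = (if (u, v) \<in> parcs H then 1 else if (v, u) \<in> parcs H then - 1 else 0)"

text \<open>The entries of the matrix whose permanent is taken, indexed by vertices instead of
  positions, so that the enumeration \<open>vs\<close> drops out of all later arguments.\<close>

definition arc_weight :: "'a pair_pre_digraph \<Rightarrow> 'a \<Rightarrow> 'a \<Rightarrow> int poly" where
  "arc_weight H u v = (if u = v then [:0, 1:] else [:- arc_sign H u v:])"

text \<open>Conjugation by the enumeration matches permutations of positions with permutations of
  vertices.\<close>

lemma permanent_reindex:
  fixes M :: "'b :: comm_ring_1 mat"
  assumes "distinct vs" and "dim_row M = length vs" and "dim_col M = length vs"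
    and M: "\<And>i j. i < length vs \<Longrightarrow> j < length vs \<Longrightarrow> M $$ (i, j) = w (vs ! i) (vs ! j)"
  shows "permanent M = (\<Sum>p | p permutes set vs. perm_term w (set vs) p)"
proof -
  let ?n = "length vs"
  \<comment> \<open>\<open>\<pi>\<close> conjugated by the enumeration, extended by the identity
    outside \<open>set vs\<close>.\<close>
  let ?F = "\<lambda>\<pi> x. if x \<in> set vs then vs ! (\<pi> (inv_into {0..<?n} ((!) vs) x)) else x"
  have bij: "bij_betw ((!) vs) {0..<?n} (set vs)"
    using assms(1) by (simp add: atLeast0LessThan bij_betw_nth)
  have "(\<Prod>i = 0..<?n. M $$ (i, \<pi> i)) = perm_term w (set vs) (?F \<pi>)"
    if "\<pi> permutes {0..<?n}" for \<pi>
  proof -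
    have "perm_term w (set vs) (?F \<pi>) = (\<Prod>i = 0..<?n. w (vs ! i) (?F \<pi> (vs ! i)))"
      unfolding perm_term_def using bij by (rule prod.reindex_bij_betw [symmetric])
    also have "\<dots> = (\<Prod>i = 0..<?n. M $$ (i, \<pi> i))"
    proof (rule prod.cong [OF refl])
      fix i assume i: "i \<in> {0..<?n}"
      then have "\<pi> i \<in> {0..<?n}"
        using that by (simp add: permutes_in_image)
      moreover have "inv_into {0..<?n} ((!) vs) (vs ! i) = i"
        using bij i by (meson bij_betw_def inv_into_f_f)
      ultimately show "w (vs ! i) (?F \<pi> (vs ! i)) = M $$ (i, \<pi> i)"
        using i by (simp add: M)
    qed
    finally show ?thesis ..
  qed
  then have "permanent M = (\<Sum>\<pi> | \<pi> permutes {0..<?n}. perm_term w (set vs) (?F \<pi>))"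
    unfolding permanent_def using assms(2,3) by simp
  also have "\<dots> = (\<Sum>p | p permutes set vs. perm_term w (set vs) p)"
    by (rule sum.reindex_bij_betw [OF bij_betw_permutations [OF bij]])
  finally show ?thesis .
qed

lemma permanental_poly_conv:
  assumes "distinct vs" and "\<And>v. (v, v) \<notin> parcs H"
  shows "permanental_poly vs H
    = (\<Sum>p | p permutes set vs. perm_term (arc_weight H) (set vs) p)"
  unfolding permanental_poly_def
proof (rule permanent_reindex [OF assms(1)])
  fix i j assume "i < length vs" "j < length vs"
  then show "char_poly_matrix (skew_adjacency_mat vs H) $$ (i, j) = arc_weight H (vs ! i) (vs ! j)"
    using assms by (auto simp: char_poly_matrix_def skew_adjacency_mat_def arc_weight_def
        arc_sign_def nth_eq_iff_index_eq)
qed (simp_all add: char_poly_matrix_def skew_adjacency_mat_def)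

lemma prod_monom:
  "(\<Prod>x\<in>A. monom (f x :: 'b :: comm_semiring_1) (g x)) = monom (\<Prod>x\<in>A. f x) (\<Sum>x\<in>A. g x)"
  by (induction A rule: infinite_finite_induct) (simp_all add: mult_monom)

text \<open>A fixed vertex contributes the factor x and a moved one a constant, so every term is a
  monomial and single coefficients can be read off by counting fixed points.\<close>

lemma perm_term_arc_weight:
  assumes "finite V"
  shows "perm_term (arc_weight H) V p
    = monom (\<Prod>v | v \<in> V \<and> p v \<noteq> v. - arc_sign H v (p v)) (card {v \<in> V. p v = v})"
proof -
  have "perm_term (arc_weight H) V p
      = (\<Prod>v\<in>V. monom (if p v \<noteq> v then - arc_sign H v (p v) else 1) (if p v = v then 1 else 0))"
    unfolding perm_term_def
    by (rule prod.cong) (auto simp: arc_weight_def x_as_monom monom_0)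
  also have "\<dots> = monom (\<Prod>v | v \<in> V \<and> p v \<noteq> v. - arc_sign H v (p v)) (card {v \<in> V. p v = v})"
    using assms by (simp add: prod_monom prod.inter_filter [symmetric] sum.inter_filter [symmetric])
  finally show ?thesis .
qed

section \<open>Cycles as closed vertex sequences\<close>

lemma graph_cycleI:
  assumes "c 0 \<in> pverts G" and "inj_on c {..<m}" and "c m = c 0" and "3 \<le> m"
    and arcs: "\<And>i. i < m \<Longrightarrow> (c i, c (Suc i)) \<in> parcs G"
  shows "graph_cycle G (map (\<lambda>i. (c i, c (Suc i))) [0..<m])" (is "graph_cycle G ?p")
proof -
  \<comment> \<open>Stated for all segments from \<open>a\<close> to \<open>b\<close>, so that the
    start \<open>a\<close> can descend from \<open>b\<close> in the induction.\<close>
  have "pcas (c a) (map (\<lambda>i. (c i, c (Suc i))) [a..<b]) (c b)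
      \<and> pawalk_verts (c a) (map (\<lambda>i. (c i, c (Suc i))) [a..<b]) = map c [a..<Suc b]"
    if "a \<le> b" for a b
    using that by (induction a rule: inc_induct) (auto simp: upt_conv_Cons simp del: upt_Suc)
  from this [of 0 m] have "pcas (c 0) ?p (c 0)" and *: "pawalk_verts (c 0) ?p = map c [0..<Suc m]"
    using assms(3) by auto
  moreover have "map c [0..<Suc m] = c 0 # map c [1..<m] @ [c 0]"
    using \<open>3 \<le> m\<close> \<open>c m = c 0\<close> by (simp add: upt_conv_Cons)
  moreover have "distinct (map c [1..<m] @ [c 0])"
  proof -
    have "distinct (map c [0..<m])"
      using assms(2) by (simp add: distinct_map atLeast0LessThan)
    then show ?thesis
      using \<open>3 \<le> m\<close> by (auto simp: upt_conv_Cons)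
  qed
  ultimately show ?thesis
    using assms(1,4) arcs
    by (auto simp: graph_cycle_def pre_digraph.cycle_def pre_digraph.awalk_def
        cas_with_proj_eq awalk_verts_with_proj_eq intro!: exI [of _ "c 0"])
qed

lemma graph_cycleE:
  assumes "graph_cycle G p"
  obtains c where "inj_on c {..<length p}" and "c (length p) = c 0" and "3 \<le> length p"
    and "\<And>i. i < length p \<Longrightarrow> (c i, c (Suc i)) \<in> parcs G"
proof -
  let ?m = "length p"
  obtain u where p: "set p \<subseteq> parcs G" "pcas u p u" "distinct (tl (pawalk_verts u p))" "3 \<le> ?m"
    using assms by (auto simp: graph_cycle_def pre_digraph.cycle_def pre_digraph.awalk_def
        cas_with_proj_eq awalk_verts_with_proj_eq)
  have walk: "pawalk_verts x q ! 0 = x \<and> pawalk_verts x q ! length q = y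
      \<and> length (pawalk_verts x q) = Suc (length q)
      \<and> (\<forall>i < length q. q ! i = (pawalk_verts x q ! i, pawalk_verts x q ! Suc i))"
    if "pcas x q y" for x y :: 'a and q
    using that
  proof (induction q arbitrary: x)
    case (Cons e q)
    then show ?case
      by (auto simp: less_Suc_eq_0_disj prod_eq_iff)
  qed simp
  let ?c = "(!) (pawalk_verts u p)"
  have c: "?c 0 = u" "?c ?m = u" and len: "length (pawalk_verts u p) = Suc ?m"
    and nth: "\<And>i. i < ?m \<Longrightarrow> p ! i = (?c i, ?c (Suc i))"
    using walk [OF p(2)] by auto
  have inj: "i = j" if "?c (Suc i) = ?c (Suc j)" "i < ?m" "j < ?m" for i j
    using p(3) that len by (metis Suc_less_eq diff_Suc_1 length_tl nth_eq_iff_index_eq nth_tl)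
  have "inj_on ?c {..<?m}"
  proof (rule inj_onI)
    fix i j assume ij: "i \<in> {..<?m}" "j \<in> {..<?m}" "?c i = ?c j"
    \<comment> \<open>The cyclic predecessor. A cycle is only known to have a distinct vertex list
      without its first entry, that is, at the indices \<open>Suc k\<close>, so injectivity is
      transferred back by one step.\<close>
    define pre where "pre k = (case k of 0 \<Rightarrow> ?m - 1 | Suc k \<Rightarrow> k)" for k :: nat
    have pre: "?c (Suc (pre k)) = ?c k \<and> pre k < ?m" if "k < ?m" for k
      using that p(4) c by (auto simp: pre_def split: nat.split)
    then have "pre i = pre j"
      using ij by (intro inj) auto
    then show "i = j"
      using ij by (auto simp: pre_def split: nat.splits)
  qed
  moreover have "(?c i, ?c (Suc i)) \<in> parcs G" if "i < ?m" for i
    using p(1) nth that by (metis nth_mem subsetD)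
  ultimately show thesis
    using that c p(4) by metis
qed

section \<open>Reversal of orbits\<close>

definition reverse_orbit :: "('a \<Rightarrow> 'a) \<Rightarrow> 'a \<Rightarrow> 'a \<Rightarrow> 'a" where
  "reverse_orbit p v x = (if x \<in> orbit p v then Hilbert_Choice.inv p x else p x)"

text \<open>As \<open>p\<close> maps the orbit and its complement to themselves, the two pieces fit
  together to a permutation with the same orbit of \<open>v\<close>. Squaring \<open>p\<close> and
  squaring its inverse fix the same points.\<close>

lemma
  assumes p: "p permutes V" and "finite V"
  shows reverse_orbit_permutes: "reverse_orbit p v permutes V"
    and reverse_orbit_reverse_orbit: "reverse_orbit (reverse_orbit p v) v = p"
    and reverse_orbit_involution_iff:
      "reverse_orbit p v (reverse_orbit p v x) = x \<longleftrightarrow> p (p x) = x"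
proof -
  let ?A = "orbit p v" and ?r = "reverse_orbit p v" and ?q = "Hilbert_Choice.inv p"
  have q: "p (?q x) = x" "?q (p x) = x" for x
    using p by (simp_all add: permutes_inverses)
  have perm: "permutation p"
    using assms by (auto simp: permutation_permutes)
  have A: "p x \<in> ?A \<longleftrightarrow> x \<in> ?A" for x
    using cyclic_on_orbit [OF assms] cyclic_on_f_in [OF p] orbit.step by metis
  have A': "?q x \<in> ?A \<longleftrightarrow> x \<in> ?A" for x
    using A [of "?q x"] by (simp add: q)
  \<comment> \<open>The inverse of the reversed permutation: the roles of \<open>p\<close> and its
    inverse are exchanged.\<close>
  define g where "g x = (if x \<in> ?A then p x else ?q x)" for x
  have gr: "g (?r x) = x" and rg: "?r (g x) = x" for x
    by (simp_all add: g_def reverse_orbit_def A A' q)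
  have "?r x = x" if "x \<notin> V" for x
    using that p permutes_inv [OF p] by (simp add: reverse_orbit_def permutes_not_in)
  then show "?r permutes V"
    unfolding permutes_def using gr rg by metis
  have inv_r: "Hilbert_Choice.inv ?r = g"
    by (rule inv_equality) (simp_all add: gr rg)
  have "orbit ?r v = orbit ?q v"
    by (rule orbit_cong)
      (simp_all add: perm permutation_inverse permutation_self_in_orbit orbit_inv_eq reverse_orbit_def)
  then have "orbit ?r v = ?A"
    by (simp add: perm orbit_inv_eq)
  then show "reverse_orbit ?r v = p"
    by (auto simp: fun_eq_iff reverse_orbit_def [of ?r] inv_r g_def) (simp add: reverse_orbit_def)
  have "?q (?q x) = x \<longleftrightarrow> p (p x) = x"
    using q by metis
  then show "?r (?r x) = x \<longleftrightarrow> p (p x) = x"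
    by (simp add: reverse_orbit_def A A')
qed

lemma orbit_no_fixpoint:
  assumes p: "p permutes V" "finite V" and "p v \<noteq> v" and x: "x \<in> orbit p v"
  shows "p x \<noteq> x"
proof
  assume "p x = x"
  then have "orbit p x = {x}"
    by (simp add: orbit_eq_singleton_iff)
  moreover have "orbit p x = orbit p v"
    using cyclic_on_orbit [OF p] x by (rule orbit_cyclic_eq3)
  moreover have "v \<in> orbit p v"
    using p by (meson permutation_permutes permutation_self_in_orbit)
  ultimately show False
    using \<open>p v \<noteq> v\<close> \<open>p x = x\<close> by simp
qed

text \<open>By antisymmetry each factor on the orbit changes sign. If no factor vanishes, their
  number is odd and the product is negated; otherwise both products are 0. Antisymmetry is asked
  only off the diagonal, where the later weights have the entry x.\<close>

lemma perm_term_reverse_orbit: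
  fixes w :: "'a \<Rightarrow> 'a \<Rightarrow> 'b :: idom"
  assumes p: "p permutes V" and fin: "finite V" and v: "p (p v) \<noteq> v"
    and anti: "\<And>x y. x \<noteq> y \<Longrightarrow> w y x = - w x y"
    and odd: "(\<And>x. x \<in> orbit p v \<Longrightarrow> w x (p x) \<noteq> 0) \<Longrightarrow> odd (card (orbit p v))"
  shows "perm_term w V (reverse_orbit p v) = - perm_term w V p"
proof -
  let ?A = "orbit p v"
  have "v \<in> V"
    using v p by (metis permutes_not_in)
  with p have AV: "?A \<subseteq> V"
    by (rule permutes_orbit_subset)
  then have finA: "finite ?A"
    using fin by (rule finite_subset)
  have "p ` ?A = ?A"
    by (rule endo_inj_surj [OF finA])
      (auto intro: orbit.step inj_on_subset [OF permutes_inj [OF p]])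
  then have bij: "bij_betw p ?A ?A"
    using permutes_inj [OF p] by (simp add: bij_betw_def inj_on_def)
  have "p v \<noteq> v"
    using v by auto
  then have nofix: "p x \<noteq> x" if "x \<in> ?A" for x
    using orbit_no_fixpoint [OF p fin _ that] by simp
  \<comment> \<open>Reindexing along \<open>p\<close> pairs each reversed arc with the original
    one.\<close>
  have "(\<Prod>x\<in>?A. w x (Hilbert_Choice.inv p x)) = (\<Prod>x\<in>?A. w (p x) (Hilbert_Choice.inv p (p x)))"
    by (rule prod.reindex_bij_betw [OF bij, symmetric])
  also have "\<dots> = (\<Prod>x\<in>?A. - w x (p x))"
    using anti [OF nofix [symmetric]] by (intro prod.cong) (simp_all add: permutes_inverses [OF p])
  also have "\<dots> = - (\<Prod>x\<in>?A. w x (p x))"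
  proof (cases "\<forall>x\<in>?A. w x (p x) \<noteq> 0")
    case True
    then have "odd (card ?A)"
      using odd by blast
    then show ?thesis
      using prod_uminus [of "\<lambda>x. w x (p x)" ?A] by simp
  next
    case False
    then have "(\<Prod>x\<in>?A. w x (p x)) = 0" "(\<Prod>x\<in>?A. - w x (p x)) = 0"
      using finA by (auto simp: prod_zero_iff)
    then show ?thesis
      by simp
  qed
  finally have A: "(\<Prod>x\<in>?A. w x (Hilbert_Choice.inv p x)) = - (\<Prod>x\<in>?A. w x (p x))" .
  have "perm_term w V (reverse_orbit p v)
      = (\<Prod>x\<in>V - ?A. w x (reverse_orbit p v x)) * (\<Prod>x\<in>?A. w x (reverse_orbit p v x))"
    unfolding perm_term_def by (rule prod.subset_diff [OF AV fin])
  also have "\<dots> = (\<Prod>x\<in>V - ?A. w x (p x)) * - (\<Prod>x\<in>?A. w x (p x))"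
    unfolding A [symmetric]
    by (intro arg_cong2 [where f = "(*)"] prod.cong) (auto simp: reverse_orbit_def)
  also have "\<dots> = - perm_term w V p"
    unfolding perm_term_def by (simp add: prod.subset_diff [OF AV fin])
  finally show ?thesis .
qed

text \<open>A sign-reversing involution on the permutations that are not involutions makes their
  terms cancel.\<close>

lemma sum_perm_term_eq_sum_involutions:
  fixes w :: "'a \<Rightarrow> 'a \<Rightarrow> 'b :: {idom, ring_char_0}"
  assumes fin: "finite V"
    and anti: "\<And>x y. x \<noteq> y \<Longrightarrow> w y x = - w x y"
    and odd: "\<And>p v. p permutes V \<Longrightarrow> p (p v) \<noteq> v \<Longrightarrow>
      (\<And>x. x \<in> orbit p v \<Longrightarrow> w x (p x) \<noteq> 0) \<Longrightarrow> odd (card (orbit p v))"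
  shows "(\<Sum>p | p permutes V. perm_term w V p)
    = (\<Sum>p | p permutes V \<and> (\<forall>v. p (p v) = v). perm_term w V p)"
proof -
  let ?S = "{p. p permutes V \<and> (\<exists>v. p (p v) \<noteq> v)}"
  let ?T = "{p. p permutes V \<and> (\<forall>v. p (p v) = v)}"
  \<comment> \<open>Reversal preserves the set of all \<open>v\<close> with
    \<open>p (p v) \<noteq> v\<close>, so \<open>SOME\<close> picks the same vertex again and
    \<open>\<phi>\<close> is its own inverse.\<close>
  define \<phi> where "\<phi> p = reverse_orbit p (SOME v. p (p v) \<noteq> v)" for p :: "'a \<Rightarrow> 'a"
  have 1: "p permutes V" "p (p (SOME v. p (p v) \<noteq> v)) \<noteq> (SOME v. p (p v) \<noteq> v)" if "p \<in> ?S" for p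
    using that someI_ex [of "\<lambda>v. p (p v) \<noteq> v"] by auto
  have 2: "\<phi> p \<in> ?S" "\<phi> (\<phi> p) = p" if "p \<in> ?S" for p
    using that reverse_orbit_permutes [OF _ fin] reverse_orbit_reverse_orbit [OF _ fin]
      reverse_orbit_involution_iff [OF _ fin]
    by (simp_all add: \<phi>_def)
  have "(\<Sum>p\<in>?S. perm_term w V p) = (\<Sum>p\<in>?S. - perm_term w V p)"
  proof (rule sum.reindex_bij_witness [of _ \<phi> \<phi>])
    fix p assume p: "p \<in> ?S"
    have "perm_term w V (\<phi> p) = - perm_term w V p"
      unfolding \<phi>_def using 1 [OF p] fin anti odd by (intro perm_term_reverse_orbit) blast+
    then show "- perm_term w V (\<phi> p) = perm_term w V p"
      by simp
  qed (use 2 in auto)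
  then have "(\<Sum>p\<in>?S. perm_term w V p) = 0"
    by (simp add: sum_negf eq_neg_iff_add_eq_0 flip: mult_2)
  moreover have "(\<Sum>p\<in>?S \<union> ?T. perm_term w V p)
      = (\<Sum>p\<in>?S. perm_term w V p) + (\<Sum>p\<in>?T. perm_term w V p)"
    using finite_permutations [OF fin] by (intro sum.union_disjoint) auto
  moreover have "?S \<union> ?T = {p. p permutes V}"
    by blast
  ultimately show ?thesis
    by (simp only: add_0)
qed

text \<open>An involution consists of fixed points and swapped pairs, so weights enter only through
  the diagonal and the products over pairs.\<close>

lemma perm_term_involution_cong:
  fixes w w' :: "'a \<Rightarrow> 'a \<Rightarrow> 'b :: comm_ring_1"
  assumes p: "p permutes V" and fin: "finite V" and invol: "\<And>v. p (p v) = v"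
    and diag: "\<And>v. w v v = w' v v"
    and pair: "\<And>u v. u \<noteq> v \<Longrightarrow> w u v * w v u = w' u v * w' v u"
  shows "perm_term w V p = perm_term w' V p"
proof -
  \<comment> \<open>The numbering serves as a linear order that singles out one vertex of each
    swapped pair.\<close>
  obtain f :: "'a \<Rightarrow> nat" where f: "inj_on f V"
    using finite_imp_inj_to_nat_seg [OF fin] by auto
  let ?F = "{v \<in> V. p v = v}" and ?L = "{v \<in> V. f v < f (p v)}" and ?R = "{v \<in> V. f (p v) < f v}"
  have pV: "p v \<in> V \<longleftrightarrow> v \<in> V" for v
    using p by (rule permutes_in_image)
  have V: "V = ?F \<union> (?L \<union> ?R)"
    using f pV by (force simp: inj_on_def linorder_neq_iff)
  have bij: "bij_betw p ?L ?R"
    by (rule bij_betw_byWitness [where f' = p]) (auto simp: invol pV)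
  have split: "perm_term u V p = (\<Prod>v\<in>?F. u v v) * (\<Prod>v\<in>?L. u v (p v) * u (p v) v)"
    for u :: "'a \<Rightarrow> 'a \<Rightarrow> 'b"
  proof -
    have "(\<Prod>v\<in>?R. u v (p v)) = (\<Prod>v\<in>?L. u (p v) (p (p v)))"
      by (rule prod.reindex_bij_betw [OF bij, symmetric])
    moreover have "perm_term u V p = (\<Prod>v\<in>?F. u v (p v)) * (\<Prod>v\<in>?L \<union> ?R. u v (p v))"
      unfolding perm_term_def by (subst V, rule prod.union_disjoint) (use fin in auto)
    moreover have "(\<Prod>v\<in>?L \<union> ?R. u v (p v)) = (\<Prod>v\<in>?L. u v (p v)) * (\<Prod>v\<in>?R. u v (p v))"
      by (rule prod.union_disjoint) (use fin in auto)
    ultimately show ?thesis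
      by (simp add: invol prod.distrib)
  qed
  have "w v (p v) * w (p v) v = w' v (p v) * w' (p v) v" if "v \<in> ?L" for v
    using that by (intro pair) auto
  then show ?thesis
    unfolding split diag by simp
qed

section \<open>Signs of orientations, and graphs without even cycles\<close>

lemma
  assumes "pair_graph G" and "orientation G H"
  shows arc_sign_eq_0_iff: "arc_sign H u v = 0 \<longleftrightarrow> (u, v) \<notin> parcs G"
    and arc_sign_commute: "arc_sign H v u = - arc_sign H u v"
    and arc_sign_square: "arc_sign H u v * arc_sign H u v = (if (u, v) \<in> parcs G then 1 else 0)"
    and orientation_loopfree: "(u, u) \<notin> parcs H"
proof -
  interpret pair_graph G by fact
  have sym: "(x, y) \<in> parcs G \<longleftrightarrow> (y, x) \<in> parcs G" for x y
    using pair_sym_arcs by (auto simp: symmetric_def dest: symD)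
  have loop: "(x, x) \<notin> parcs G" for x
    using pair_no_loops by fastforce
  have sub: "(x, y) \<in> parcs H \<Longrightarrow> (x, y) \<in> parcs G"
    and some: "(x, y) \<in> parcs G \<Longrightarrow> (x, y) \<in> parcs H \<or> (y, x) \<in> parcs H"
    and not_both: "\<not> ((x, y) \<in> parcs H \<and> (y, x) \<in> parcs H)" for x y
    using assms(2) by (auto simp: orientation_def)
  show "arc_sign H u v = 0 \<longleftrightarrow> (u, v) \<notin> parcs G" "arc_sign H v u = - arc_sign H u v"
    "arc_sign H u v * arc_sign H u v = (if (u, v) \<in> parcs G then 1 else 0)"
    "(u, u) \<notin> parcs H"
    using sub [of u v] sub [of v u] sub [of u u] some [of u v] not_both [of u v] sym [of u v] loop [of u]
    by (auto simp: arc_sign_def)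
qed

text \<open>Direct every edge towards the end with the larger number. This supplies the orientation
  on which the contradiction for an even cycle is built.\<close>

lemma exists_orientation:
  assumes "pair_graph G"
  shows "\<exists>H. orientation G H"
proof -
  interpret pair_graph G by fact
  obtain f :: "'a \<Rightarrow> nat" where f: "inj_on f (pverts G)"
    using finite_imp_inj_to_nat_seg [OF pair_finite_verts] by auto
  have "(y, x) \<in> parcs G" if "(x, y) \<in> parcs G" for x y
    using that pair_sym_arcs by (auto simp: symmetric_def dest: symD)
  moreover have "f x \<noteq> f y" if "(x, y) \<in> parcs G" for x y
    using that f pair_no_loops [OF that] in_arcsD1 in_arcsD2 by (auto simp: inj_on_def)
  ultimately have "orientation G \<lparr>pverts = pverts G, parcs = {(x, y) \<in> parcs G. f x < f y}\<rparr>"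
    by (fastforce simp: orientation_def)
  then show ?thesis ..
qed

text \<open>The iterates of \<open>v\<close> are distinct up to the first return to
  \<open>v\<close>; the assumption on \<open>p (p v)\<close> rules out a return after one or two
  steps.\<close>

lemma orbit_graph_cycle:
  assumes G: "pair_graph G" and p: "p permutes pverts G" and v: "p (p v) \<noteq> v"
    and arcs: "\<And>x. x \<in> orbit p v \<Longrightarrow> (x, p x) \<in> parcs G"
  shows "\<exists>q. graph_cycle G q \<and> length q = card (orbit p v)"
proof -
  interpret pair_graph G by fact
  \<comment> \<open>The least positive number of steps after which \<open>p\<close> returns to
    \<open>v\<close>.\<close>
  let ?m = "funpow_dist1 p v v" and ?c = "\<lambda>i. (p ^^ i) v"
  have self: "v \<in> orbit p v"
    using p pair_finite_verts by (meson permutation_permutes permutation_self_in_orbit)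
  have inj: "inj_on ?c {..<?m}"
    using inj_on_funpow_dist1 [OF self] by (simp add: atLeast0LessThan)
  have close: "?c ?m = v"
    using self by (rule funpow_dist1_prop)
  have card: "card (orbit p v) = ?m"
    using inj by (simp add: orbit_conv_funpow_dist1 [OF self] card_image atLeast0LessThan)
  have "(p ^^ 1) v \<noteq> v" "(p ^^ 2) v \<noteq> v"
    using v by (auto simp: numeral_2_eq_2)
  then have "?m \<noteq> 1" "?m \<noteq> 2"
    using close by metis+
  then have "3 \<le> ?m"
    by linarith
  moreover have "v \<in> pverts G"
    using v p by (metis permutes_not_in)
  moreover have "(?c i, ?c (Suc i)) \<in> parcs G" for i
    using arcs [OF funpow_in_orbit [OF self, of i]] by simp
  ultimately have "graph_cycle G (map (\<lambda>i. (?c i, ?c (Suc i))) [0..<?m])"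
    using inj close by (intro graph_cycleI) auto
  moreover have "length (map (\<lambda>i. (?c i, ?c (Suc i))) [0..<?m]) = card (orbit p v)"
    by (simp add: card)
  ultimately show ?thesis
    by blast
qed

lemma permanental_poly_eq_if_no_even_cycle:
  assumes G: "pair_graph G" and vs: "distinct vs" "set vs = pverts G"
    and no_even: "\<not> (\<exists>p. graph_cycle G p \<and> even (length p))"
    and H: "orientation G H" and H': "orientation G H'"
  shows "permanental_poly vs H = permanental_poly vs H'"
proof -
  interpret pair_graph G by fact
  let ?V = "pverts G"
  have *: "permanental_poly vs K
      = (\<Sum>p | p permutes ?V \<and> (\<forall>v. p (p v) = v). perm_term (arc_weight K) ?V p)"
    if K: "orientation G K" for K
  proof -
    have "permanental_poly vs K = (\<Sum>p | p permutes ?V. perm_term (arc_weight K) ?V p)"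
      using permanental_poly_conv [OF vs(1)] orientation_loopfree [OF G K] vs(2) by simp
    also have "\<dots> = (\<Sum>p | p permutes ?V \<and> (\<forall>v. p (p v) = v). perm_term (arc_weight K) ?V p)"
    proof (rule sum_perm_term_eq_sum_involutions [OF pair_finite_verts])
      fix x y :: 'a assume "x \<noteq> y"
      then show "arc_weight K y x = - arc_weight K x y"
        using arc_sign_commute [OF G K, of x y] by (simp add: arc_weight_def)
    next
      fix p v
      assume p: "p permutes ?V" and v: "p (p v) \<noteq> v"
        and nz: "\<And>x. x \<in> orbit p v \<Longrightarrow> arc_weight K x (p x) \<noteq> 0"
      have "(x, p x) \<in> parcs G" if x: "x \<in> orbit p v" for x
      proof -
        have "p v \<noteq> v"
          using v by auto
        then have "p x \<noteq> x"
          using orbit_no_fixpoint [OF p pair_finite_verts _ x] by simp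
        then show ?thesis
          using nz [OF x] arc_sign_eq_0_iff [OF G K, of x "p x"] by (auto simp: arc_weight_def)
      qed
      then show "odd (card (orbit p v))"
        using orbit_graph_cycle [OF G p v] no_even by metis
    qed
    finally show ?thesis .
  qed
  \<comment> \<open>The two signs of an edge are opposite, so their product is -1 for either
    direction.\<close>
  have pair: "arc_weight K u v * arc_weight K v u = (if (u, v) \<in> parcs G then [:- 1:] else 0)"
    if K: "orientation G K" and "u \<noteq> v" for K u v
    using that(2) arc_sign_commute [OF G K, of u v] arc_sign_square [OF G K, of u v]
    by (simp add: arc_weight_def)
  have "perm_term (arc_weight H) ?V p = perm_term (arc_weight H') ?V p"
    if "p permutes ?V" and "\<And>v. p (p v) = v" for p
    using that(1) pair_finite_verts that(2)
  proof (rule perm_term_involution_cong)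
    fix u v :: 'a
    assume "u \<noteq> v"
    then show "arc_weight H u v * arc_weight H v u = arc_weight H' u v * arc_weight H' v u"
      using pair [OF H] pair [OF H'] by metis
  qed (simp add: arc_weight_def)
  then show ?thesis
    unfolding * [OF H] * [OF H'] by (intro sum.cong) auto
qed

section \<open>Flipping arcs\<close>

definition flip_arc :: "'a pair_pre_digraph \<Rightarrow> 'a \<Rightarrow> 'a \<Rightarrow> 'a pair_pre_digraph" where
  "flip_arc H u v = H\<lparr>parcs := {(x, y). if {x, y} = {u, v} then (y, x) \<in> parcs H else (x, y) \<in> parcs H}\<rparr>"

lemma orientation_flip_arc:
  assumes "pair_graph G" and "orientation G H"
  shows "orientation G (flip_arc H u v)"
proof -
  interpret pair_graph G by fact
  have "(y, x) \<in> parcs G" if "(x, y) \<in> parcs G" for x y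
    using that pair_sym_arcs by (auto simp: symmetric_def dest: symD)
  then show ?thesis
    using assms(2) unfolding orientation_def flip_arc_def
    by (auto simp: insert_commute split: if_splits)
qed

text \<open>The flip negates the two entries of the edge. A permutation that swaps \<open>u\<close>
  and \<open>v\<close> uses both, and the signs cancel.\<close>

lemma perm_term_flip_arc:
  assumes G: "pair_graph G" and H: "orientation G H"
    and "finite V" and uv: "u \<in> V" "v \<in> V" "u \<noteq> v"
  shows "perm_term (arc_weight (flip_arc H u v)) V p
    = (if (p u = v) \<noteq> (p v = u) then - 1 else 1) * perm_term (arc_weight H) V p"
proof -
  let ?\<epsilon> = "\<lambda>x. if {x, p x} = {u, v} then - 1 else 1 :: int poly"
  have "arc_sign (flip_arc H u v) x y = (if {x, y} = {u, v} then arc_sign H y x else arc_sign H x y)"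
    for x y
    by (simp add: arc_sign_def flip_arc_def insert_commute)
  then have "arc_weight (flip_arc H u v) x (p x) = ?\<epsilon> x * arc_weight H x (p x)" for x
    using \<open>u \<noteq> v\<close> arc_sign_commute [OF G H, of x "p x"] by (auto simp: arc_weight_def)
  then have "perm_term (arc_weight (flip_arc H u v)) V p = (\<Prod>x\<in>V. ?\<epsilon> x) * perm_term (arc_weight H) V p"
    by (simp add: perm_term_def prod.distrib)
  \<comment> \<open>Only the rows of the two ends can carry a sign.\<close>
  also have "(\<Prod>x\<in>V. ?\<epsilon> x) = (\<Prod>x\<in>{u, v}. ?\<epsilon> x)"
    using \<open>finite V\<close> uv by (intro prod.mono_neutral_right) (auto simp: doubleton_eq_iff)
  also have "\<dots> = (if (p u = v) \<noteq> (p v = u) then - 1 else 1)"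
    using \<open>u \<noteq> v\<close> by (auto simp: doubleton_eq_iff)
  finally show ?thesis .
qed

text \<open>Inequality of truth values is exclusive or: a permutation that swaps the ends of an edge
  in \<open>S\<close> is excluded.\<close>

definition traversing :: "'a set \<Rightarrow> ('a \<times> 'a) set \<Rightarrow> ('a \<Rightarrow> 'a) set" where
  "traversing V S = {p. p permutes V \<and> (\<forall>(u, v)\<in>S. (p u = v) \<noteq> (p v = u))}"

lemma sum_traversing_eq_0:
  assumes G: "pair_graph G" and "finite S" and "S \<noteq> {}" and "S \<subseteq> parcs G"
    and const: "\<And>H H'. orientation G H \<Longrightarrow> orientation G H' \<Longrightarrow>
      (\<Sum>p | p permutes pverts G. perm_term (arc_weight H) (pverts G) p)
      = (\<Sum>p | p permutes pverts G. perm_term (arc_weight H') (pverts G) p)"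
    and H: "orientation G H"
  shows "(\<Sum>p\<in>traversing (pverts G) S. perm_term (arc_weight H) (pverts G) p) = 0"
proof -
  interpret pair_graph G by fact
  let ?V = "pverts G"
  let ?T = "\<lambda>H S. \<Sum>p\<in>traversing ?V S. perm_term (arc_weight H) ?V p"
  \<comment> \<open>For empty \<open>S\<close> only independence of the orientation is available;
    for nonempty \<open>S\<close> the sum vanishes, which implies independence for the next
    step.\<close>
  have "(\<forall>H H'. orientation G H \<longrightarrow> orientation G H' \<longrightarrow> ?T H S = ?T H' S)
      \<and> (S \<noteq> {} \<longrightarrow> (\<forall>H. orientation G H \<longrightarrow> ?T H S = 0))"
    using \<open>finite S\<close> \<open>S \<subseteq> parcs G\<close>
  proof (induction S rule: finite_induct)
    case empty
    have "traversing ?V {} = {p. p permutes ?V}"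
      by (simp add: traversing_def)
    then show ?case
      using const by metis
  next
    case (insert e S)
    obtain u v where e: "e = (u, v)"
      by fastforce
    then have uv: "u \<in> ?V" "v \<in> ?V" "u \<noteq> v"
      using insert.prems in_arcsD1 in_arcsD2 pair_no_loops by force+
    \<comment> \<open>Flipping \<open>e\<close> negates the terms in \<open>?A\<close> and keeps
      those in \<open>?B\<close>. As the sum over both is unchanged, the sum over \<open>?A\<close>
      equals its own negative.\<close>
    let ?A = "traversing ?V (insert e S)" and ?B = "traversing ?V S - traversing ?V (insert e S)"
    have fin: "finite (traversing ?V S)"
      using finite_permutations [OF pair_finite_verts] by (simp add: traversing_def)
    have sub: "?A \<subseteq> traversing ?V S"
      by (auto simp: traversing_def)
    have split: "?T K S = sum (perm_term (arc_weight K) ?V) ?B + ?T K (insert e S)" for K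
      by (rule sum.subset_diff [OF sub fin])
    have "?T H (insert e S) = 0" if H: "orientation G H" for H
    proof -
      let ?H = "flip_arc H u v"
      have flip: "perm_term (arc_weight ?H) ?V p
          = (if (p u = v) \<noteq> (p v = u) then - 1 else 1) * perm_term (arc_weight H) ?V p" for p
        by (rule perm_term_flip_arc [OF G H pair_finite_verts uv])
      have "sum (perm_term (arc_weight ?H) ?V) ?B = sum (perm_term (arc_weight H) ?V) ?B"
        by (rule sum.cong) (auto simp: flip traversing_def e)
      moreover have "?T ?H (insert e S) = - ?T H (insert e S)"
        unfolding sum_negf [symmetric]
        by (rule sum.cong) (auto simp: flip traversing_def e)
      moreover have "?T H S = ?T ?H S"
        using insert.IH insert.prems H orientation_flip_arc [OF G H] by blast
      ultimately show ?thesis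
        using split [of H] split [of ?H] by (simp add: eq_neg_iff_add_eq_0 flip: mult_2)
    qed
    then show ?case
      by simp
  qed
  then show ?thesis
    using \<open>S \<noteq> {}\<close> H by blast
qed

section \<open>Permutations traversing a cycle\<close>

text \<open>Repeating the first vertex at index \<open>m\<close> makes \<open>c (Suc i)\<close> the
  successor of \<open>c i\<close> for all \<open>i < m\<close>, without modular arithmetic.\<close>

locale closed_path =
  fixes c :: "nat \<Rightarrow> 'a" and m :: nat
  assumes inj: "inj_on c {..<m}" and closed: "c m = c 0" and length: "3 \<le> m"
begin

lemma eq_iff: "i < m \<Longrightarrow> j < m \<Longrightarrow> c i = c j \<longleftrightarrow> i = j"
  using inj by (auto simp: inj_on_def)

lemma Suc_cases:
  assumes "i < m"
  obtains "Suc i < m" | "Suc i = m" "c (Suc i) = c 0"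
  using assms closed by (metis Suc_lessI)

lemma pred:
  assumes "i < m"
  obtains j where "j < m" and "c (Suc j) = c i"
proof (cases i)
  case 0
  then show thesis
    using that [of "m - 1"] closed length by simp
next
  case (Suc j)
  then show thesis
    using that [of j] assms by simp
qed

lemma Suc_neq: "i < m \<Longrightarrow> c (Suc i) \<noteq> c i"
  by (erule Suc_cases) (use length in \<open>auto simp: eq_iff\<close>)

text \<open>Two steps back to the start would require a cycle of length 2. The premise keeps the
  index \<open>Suc (Suc i)\<close> within \<open>m\<close>, beyond which \<open>c\<close> is
  unspecified.\<close>

lemma Suc_Suc_neq:
  assumes "Suc i < m"
  shows "c (Suc (Suc i)) \<noteq> c i"
  using assms by (rule Suc_cases) (use length assms in \<open>auto simp: eq_iff\<close>)

lemma bij_betw_Suc: "bij_betw (\<lambda>i. c (Suc i)) {..<m} (c ` {..<m})"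
proof -
  have "(\<lambda>i. c (Suc i)) ` {..<m} = c ` {..<m}"
  proof (intro subset_antisym subsetI)
    fix x assume "x \<in> (\<lambda>i. c (Suc i)) ` {..<m}"
    then obtain i where "i < m" "x = c (Suc i)"
      by auto
    then show "x \<in> c ` {..<m}"
      by (cases rule: Suc_cases) (use length in auto)
  next
    fix x assume "x \<in> c ` {..<m}"
    then obtain i where "i < m" "x = c i"
      by auto
    then show "x \<in> (\<lambda>i. c (Suc i)) ` {..<m}"
      by (metis pred imageI lessThan_iff)
  qed
  \<comment> \<open>Injectivity follows from the image by counting.\<close>
  then show ?thesis
    by (simp add: bij_betw_def eq_card_imp_inj_on card_image [OF inj])
qed

abbreviation arcs where
  "arcs \<equiv> (\<lambda>i. (c i, c (Suc i))) ` {..<m}"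

text \<open>The direction on the first edge propagates: a change at a vertex would give it two
  images or two preimages under \<open>p\<close>.\<close>

lemma traversing_directions:
  assumes "p \<in> traversing V arcs"
  shows "(\<forall>i<m. p (c i) = c (Suc i)) \<or> (\<forall>i<m. p (c (Suc i)) = c i)"
proof -
  have p: "inj p" and edge: "\<And>i. i < m \<Longrightarrow> p (c i) = c (Suc i) \<or> p (c (Suc i)) = c i"
    using assms permutes_inj by (auto simp: traversing_def)
  have "p (c i) = c (Suc i)" if "p (c 0) = c (Suc 0)" "i < m" for i
    using \<open>i < m\<close>
  proof (induction i)
    case (Suc i)
    \<comment> \<open>Traversing the next edge backwards would send both of these vertices to
      \<open>c (Suc i)\<close>.\<close>
    have "p (c (Suc (Suc i))) \<noteq> p (c i)"
      using p Suc_Suc_neq [OF Suc.prems] by (simp add: inj_eq)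
    then show ?case
      using Suc edge [of "Suc i"] by simp
  qed (use that in simp)
  moreover have "p (c (Suc i)) = c i" if "p (c (Suc 0)) = c 0" "i < m" for i
    using \<open>i < m\<close>
  proof (induction i)
    case (Suc i)
    then show ?case
      using Suc_Suc_neq [of i] edge [of "Suc i"] by auto
  qed (use that in simp)
  ultimately show ?thesis
    using edge [of 0] length by auto
qed

text \<open>The witness rotates the cycle by one step and fixes everything else.\<close>

lemma exists_traversing:
  assumes "c ` {..<m} \<subseteq> V"
  obtains p where "p \<in> traversing V arcs" and "\<And>v. p v \<noteq> v \<longleftrightarrow> v \<in> c ` {..<m}"
proof -
  let ?cs = "map c [0..<m]"
  define p where "p = cycle_of_list ?cs"
  have "distinct ?cs"
    using inj by (simp add: distinct_map atLeast0LessThan)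
  then have "map p ?cs = rotate1 ?cs"
    using cyclic_rotation [of ?cs 1] by (simp add: p_def)
  then have nth: "map p ?cs ! i = rotate1 ?cs ! i" for i
    by simp
  have step: "p (c i) = c (Suc i)" if "i < m" for i
  proof -
    have "p (c i) = ?cs ! (Suc i mod m)"
      using nth [of i] that nth_rotate1 [of i ?cs] by simp
    also have "\<dots> = c (Suc i)"
      using that by (cases rule: Suc_cases) (use length closed in auto)
    finally show ?thesis .
  qed
  have perm: "p permutes c ` {..<m}"
    using cycle_permutes [of ?cs] by (simp add: p_def atLeast0LessThan)
  have "p (c (Suc i)) \<noteq> c i" if "i < m" for i
    using that
  proof (cases rule: Suc_cases)
    case 1
    then show ?thesis
      using step Suc_Suc_neq by simp
  next
    case 2
    \<comment> \<open>On the closing edge, \<open>p (c 0) = c 1\<close> differs from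
      \<open>c (m - 1)\<close> because \<open>m\<close> is at least 3.\<close>
    then show ?thesis
      using step [of 0] that length by (simp add: eq_iff)
  qed
  then have "p \<in> traversing V arcs"
    using step permutes_subset [OF perm assms] by (auto simp: traversing_def)
  moreover have "p v \<noteq> v \<longleftrightarrow> v \<in> c ` {..<m}" for v
    using permutes_not_in [OF perm, of v] step Suc_neq by auto
  ultimately show thesis
    by (rule that)
qed

text \<open>A traversing permutation moves all \<open>m\<close> cycle vertices, so those with
  \<open>card V - m\<close> fixed points move nothing else. Each contributes the same product
  \<open>?K\<close>, hence the coefficient is a positive multiple of \<open>?K\<close>; the exact
  number of rotations does not matter.\<close>

lemma coeff_sum_traversing:
  fixes H :: "'a pair_pre_digraph"
  assumes V: "finite V" "c ` {..<m} \<subseteq> V" and "even m"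
    and anti: "\<And>u v. arc_sign H v u = - arc_sign H u v"
    and nz: "\<And>i. i < m \<Longrightarrow> arc_sign H (c i) (c (Suc i)) \<noteq> 0"
  shows "coeff (\<Sum>p\<in>traversing V arcs. perm_term (arc_weight H) V p) (card V - m) \<noteq> 0"
proof -
  let ?C = "c ` {..<m}"
  let ?K = "\<Prod>i<m. arc_sign H (c i) (c (Suc i))"
  let ?fix = "\<lambda>p. {v \<in> V. p v = v}" and ?move = "\<lambda>p. {v \<in> V. p v \<noteq> v}"
  let ?A = "{p \<in> traversing V arcs. card (?fix p) = card V - m}"
  \<comment> \<open>Evenness of \<open>m\<close> enters here; it gives the forward rotation the
    value \<open>?K\<close>.\<close>
  have K: "(\<Prod>i<m. - arc_sign H (c i) (c (Suc i))) = ?K"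
    using prod_uminus [of "\<lambda>i. arc_sign H (c i) (c (Suc i))" "{..<m}"] \<open>even m\<close> by simp
  have cardC: "card ?C = m"
    using inj by (simp add: card_image)
  \<comment> \<open>Makes the natural subtraction \<open>card V - m\<close> exact.\<close>
  then have "m \<le> card V"
    using card_mono [OF V] by simp
  have card: "card V = card (?fix p) + card (?move p)" for p
  proof -
    have "V = ?fix p \<union> ?move p"
      by auto
    also have "card \<dots> = card (?fix p) + card (?move p)"
      using V(1) by (intro card_Un_disjoint) auto
    finally show ?thesis .
  qed
  have "(\<Prod>v\<in>?move p. - arc_sign H v (p v)) = ?K" if p: "p \<in> ?A" for p
  proof -
    have dir: "(\<forall>i<m. p (c i) = c (Suc i)) \<or> (\<forall>i<m. p (c (Suc i)) = c i)"
      using p traversing_directions by blast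
    have "p (c i) \<noteq> c i" if "i < m" for i
    proof -
      obtain j where "j < m" "c (Suc j) = c i"
        using pred [OF \<open>i < m\<close>] by blast
      then show ?thesis
        using dir that Suc_neq by metis
    qed
    then have "?C \<subseteq> ?move p"
      using V(2) by auto
    moreover have "card (?fix p) = card V - m"
      using p by simp
    then have "card (?move p) = m"
      using card [of p] \<open>m \<le> card V\<close> by linarith
    ultimately have "?move p = ?C"
      using V(1) cardC by (metis card_subset_eq finite_Collect_conjI finite_subset mem_Collect_eq subsetI)
    moreover have "(\<Prod>v\<in>?C. - arc_sign H v (p v)) = ?K"
      using dir
    proof
      assume "\<forall>i<m. p (c i) = c (Suc i)"
      then show ?thesis
        by (simp add: prod.reindex [OF inj] K)
    next
      \<comment> \<open>For the backward rotation, antisymmetry absorbs the minus sign of each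
        factor.\<close>
      assume *: "\<forall>i<m. p (c (Suc i)) = c i"
      have "(\<Prod>v\<in>?C. - arc_sign H v (p v)) = (\<Prod>i<m. - arc_sign H (c (Suc i)) (p (c (Suc i))))"
        by (rule prod.reindex_bij_betw [OF bij_betw_Suc, symmetric])
      also have "\<dots> = ?K"
        by (rule prod.cong) (simp_all add: * anti [of "c (Suc _)"])
      finally show ?thesis .
    qed
    ultimately show ?thesis
      by simp
  qed
  then have "(\<Sum>p\<in>?A. \<Prod>v\<in>?move p. - arc_sign H v (p v)) = of_nat (card ?A) * ?K"
    by simp
  moreover have finT: "finite (traversing V arcs)"
    using finite_permutations [OF V(1)] by (simp add: traversing_def)
  moreover have "coeff (\<Sum>p\<in>traversing V arcs. perm_term (arc_weight H) V p) (card V - m)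
      = (\<Sum>p\<in>traversing V arcs. if card (?fix p) = card V - m
          then \<Prod>v\<in>?move p. - arc_sign H v (p v) else 0)"
    by (simp add: coeff_sum perm_term_arc_weight [OF V(1)])
  ultimately have "coeff (\<Sum>p\<in>traversing V arcs. perm_term (arc_weight H) V p) (card V - m)
      = of_nat (card ?A) * ?K"
    by (simp add: sum.inter_filter)
  moreover have "?A \<noteq> {}"
  proof -
    obtain p where p: "p \<in> traversing V arcs" "\<And>v. p v \<noteq> v \<longleftrightarrow> v \<in> ?C"
      using exists_traversing [OF V(2)] by blast
    then have "?move p = ?C"
      using V(2) by blast
    then have "card (?fix p) = card V - m"
      using card [of p] cardC by simp
    then show ?thesis
      using p(1) by blast
  qed
  moreover have "?K \<noteq> 0"
    using nz by simp
  ultimately show ?thesis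
    using finT by simp
qed

end

theorem theorem3p1:
  fixes G :: "'a pair_pre_digraph" and vs :: "'a list"
  assumes "pair_graph G"
    and "distinct vs" and "set vs = pverts G"
  shows "(\<forall>H H'. orientation G H \<longrightarrow> orientation G H' \<longrightarrow>
            permanental_poly vs H = permanental_poly vs H')
         \<longleftrightarrow> \<not> (\<exists>p. graph_cycle G p \<and> even (length p))"
proof
  interpret pair_graph G by fact
  assume const: "\<forall>H H'. orientation G H \<longrightarrow> orientation G H' \<longrightarrow>
    permanental_poly vs H = permanental_poly vs H'"
  show "\<not> (\<exists>p. graph_cycle G p \<and> even (length p))"
  proof
    assume "\<exists>p. graph_cycle G p \<and> even (length p)"
    then obtain p where p: "graph_cycle G p" "even (length p)"
      by blast
    let ?m = "length p"
    obtain c where c: "inj_on c {..<?m}" "c ?m = c 0" "3 \<le> ?m"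
      and arc: "\<And>i. i < ?m \<Longrightarrow> (c i, c (Suc i)) \<in> parcs G"
      using p(1) by (elim graph_cycleE) blast
    interpret closed_path c ?m
      using c by unfold_locales
    obtain H where H: "orientation G H"
      using exists_orientation [OF assms(1)] by blast
    have poly: "permanental_poly vs K
        = (\<Sum>p | p permutes pverts G. perm_term (arc_weight K) (pverts G) p)"
      if "orientation G K" for K
      using permanental_poly_conv [OF assms(2)] orientation_loopfree [OF assms(1) that] assms(3)
      by simp
    \<comment> \<open>The edge set is the whole even cycle, each edge given by one arc.\<close>
    have "(\<Sum>p\<in>traversing (pverts G) ((\<lambda>i. (c i, c (Suc i))) ` {..<?m}).
        perm_term (arc_weight H) (pverts G) p) = 0"
    proof (rule sum_traversing_eq_0 [OF assms(1) _ _ _ _ H])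
      show "(\<lambda>i. (c i, c (Suc i))) ` {..<?m} \<noteq> {}"
        using c(3) by (auto simp: lessThan_empty_iff)
      show "(\<Sum>p | p permutes pverts G. perm_term (arc_weight K) (pverts G) p)
          = (\<Sum>p | p permutes pverts G. perm_term (arc_weight K') (pverts G) p)"
        if "orientation G K" "orientation G K'" for K K'
        using const that poly [OF that(1)] poly [OF that(2)] by metis
    qed (use arc in auto)
    moreover have "c ` {..<?m} \<subseteq> pverts G"
      using arc in_arcsD1 by auto
    ultimately show False
      using coeff_sum_traversing [OF pair_finite_verts _ p(2) arc_sign_commute [OF assms(1) H]]
        arc_sign_eq_0_iff [OF assms(1) H] arc
      by (metis coeff_0)
  qed
next
  assume "\<not> (\<exists>p. graph_cycle G p \<and> even (length p))"
  then show "\<forall>H H'. orientation G H \<longrightarrow> orientation G H' \<longrightarrow>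
      permanental_poly vs H = permanental_poly vs H'"
    using permanental_poly_eq_if_no_even_cycle [OF assms] by blast
qed

end
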